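(* Let $K\ge 1$ be the number of users, let $\mathcal{M}$ be a set of $M\ge K$ sub-carriers, and let $\bar U_k(\cdot)$ denote the average uplink rate functions defined in the context. Let $(M_1,\dots,M_K)$ be the numbers of sub-carriers produced by the following greedy procedure. Initialize $M_k=1$ for all $k\in\{1,\dots,K\}$. While $\sum_{k=1}^{K}M_k<M$, choose $k^\star\in\arg\min_{1\le k\le K}\bar U_k(M_k)$ (ties broken arbitrarily) and replace $M_{k^\star}$ by $M_{k^\star}+1$. Then this procedure is optimal for the max-min rate sub-carrier allocation problem: any partition of $\mathcal{M}$ into pairwise disjoint sets $\mathcal{M}_1,\dots,\mathcal{M}_K$ with $|\mathcal{M}_k|=M_k$ for all $k$, together with thresholds attaining the maxima in the definition of the average rates, is an optimal solution of $$\max_{(\mathcal{M}_k),\,(\gamma^{th}_{k,m})}\ \min_{1\le k\le K}\ \sum_{m\in\mathcal{M}_k} r_{k}\big(\gamma^{th}_{k,m},|\mathcal{M}_k|\big)\quad\text{subject to}\quad \bigcup_{k=1}^{K}\mathcal{M}_k=\mathcal{M},\ \ \mathcal{M}_1,\dots,\mathcal{M}_K\ \text{pairwise disjoint},$$ where $r_k$ is the expected per-sub-carrier rate function defined in the context. Equivalently, $$\min_{1\le k\le K}\bar U_k(M_k)=\max\Big\{\min_{1\le k\le K}\bar U_k(n_k)\ :\ n_1,\dots,n_K\in\mathbb{Z}_{\ge 0},\ \sum_{k=1}^{K}n_k=M\Big\}.$$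
   Context: Setting: $K$ mobile users transmit to a base station over $M$ orthogonal sub-carriers, each assigned to exactly one user. The constants are the sub-carrier spacing $B_0>0$, the noise density $N_0>0$, the path-loss exponent $\alpha>0$, the distances $d_k>0$ of users $k=1,\dots,K$ to the base station, the maximum average transmit power $P_{max}>0$ of each user, and the target bit error rate $BER\in(0,1/5)$ (so that $-\ln(5\,BER)>0$). Channel: the channel gain $\gamma_{k,m}>0$ of user $k$ on sub-carrier $m$ is a random variable with a probability density. For each $k$, the gains $\gamma_{k,m}$ are i.i.d. over sub-carriers $m$. Write $\gamma_k$ for a generic variable with this common distribution and $f_k$ for its density. Power allocation (truncated channel inversion): if user $k$ is assigned a set $\mathcal{M}_k$ of $n=|\mathcal{M}_k|\ge1$ sub-carriers, it splits its average power budget equally, so each sub-carrier has average power budget $P_{max}/n$. With threshold $\gamma^{th}$ on a sub-carrier, it transmits on that sub-carrier only when the gain is at least $\gamma^{th}$, with power inversely proportional to the gain, scaled to meet the average power budget. The resulting constant received SNR is $$\rho_k(\gamma^{th},n)=\frac{P_{max}}{n\,N_0B_0\,d_k^{\alpha}\,\int_{\gamma^{th}}^{\infty}\frac{f_k(\gamma)}{\gamma}\,d\gamma}.$$ Thresholds range over $\gamma^{th}\ge0$ with $\mathbb{P}(\gamma_k\ge\gamma^{th})>0$, and $\rho_k(\gamma^{th},n)=0$ if the integral is infinite. Rates: the expected rate of user $k$ on one of its $n$ sub-carriers with threshold $\gamma^{th}$ is $$r_k(\gamma^{th},n)=B_0\log_2\!\Big(1+\frac{1.5\,\rho_k(\gamma^{th},n)}{-\ln(5\,BER)}\Big)\,\mathbb{P}(\gamma_k\ge\gamma^{th}).$$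 The average uplink rate of user $k$ when it is assigned $n$ sub-carriers, with thresholds optimized, is $$\bar U_k(n)=n\,\max_{\gamma^{th}} r_k(\gamma^{th},n)\quad(n\ge1),\qquad \bar U_k(0)=0.$$ A user with an empty set of sub-carriers has rate $0$ (empty sum). *)

theory Defs
  imports "HOL-Probability.Probability"
begin

record uplink =
  spacing :: real                         (* B_0 *)
  noise :: real                           (* N_0 *)
  path_loss :: real                       (* alpha *)
  distance :: "nat \<Rightarrow> real"               (* d_k *)
  max_power :: real                       (* P_max *)
  ber :: real                             (* BER *)
  gain_pdf :: "nat \<Rightarrow> real \<Rightarrow> real"       (* f_k *)

text \<open>
  The users are \<open>1, \<dots>, K\<close>, \<open>C\<close> is the set of sub-carriers, and \<open>gain k m\<close> is the channel
  gain of user \<open>k\<close> on sub-carrier \<open>m\<close>.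
\<close>

locale uplink_channel = prob_space P
  for P :: "'w measure" and S :: uplink and K :: nat and C :: "'m set"
    and gain :: "nat \<Rightarrow> 'm \<Rightarrow> 'w \<Rightarrow> real" +
  assumes spacing_pos: "0 < spacing S"
    and noise_pos: "0 < noise S"
    and path_loss_pos: "0 < path_loss S"
    and distance_pos: "\<And>k. k \<in> {1..K} \<Longrightarrow> 0 < distance S k"
    and max_power_pos: "0 < max_power S"
    and ber_bounds: "0 < ber S" "ber S < 1 / 5"
    and pdf_nonneg: "\<And>k x. k \<in> {1..K} \<Longrightarrow> 0 \<le> gain_pdf S k x"
    and gain_distributed: "\<And>k m. k \<in> {1..K} \<Longrightarrow> m \<in> C \<Longrightarrow>
          distributed P lborel (gain k m) (\<lambda>x. ennreal (gain_pdf S k x))"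
    and gain_pos: "\<And>k m. k \<in> {1..K} \<Longrightarrow> m \<in> C \<Longrightarrow> AE \<omega> in P. 0 < gain k m \<omega>"
    and gain_indep: "\<And>k. k \<in> {1..K} \<Longrightarrow> indep_vars (\<lambda>_. borel) (gain k) C"

definition gain_distr :: "uplink \<Rightarrow> nat \<Rightarrow> real measure" where
  "gain_distr S k = density lborel (\<lambda>x. ennreal (gain_pdf S k x))"

definition tail_prob :: "uplink \<Rightarrow> nat \<Rightarrow> real \<Rightarrow> real" where
  "tail_prob S k t = measure (gain_distr S k) {t..}"

lemma (in uplink_channel) prob_gain_ge:
  assumes "k \<in> {1..K}" "m \<in> C"
  shows "prob {\<omega> \<in> space P. t \<le> gain k m \<omega>} = tail_prob S k t"
proof -
  note D = gain_distributed[OF assms]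
  have "gain k m \<in> borel_measurable P"
    using distributed_measurable[OF D] by simp
  moreover have "gain k m -` {t..} \<inter> space P = {\<omega> \<in> space P. t \<le> gain k m \<omega>}"
    by auto
  ultimately show ?thesis
    using measure_distr[of "gain k m" P lborel "{t..}"] distributed_distr_eq_density[OF D]
    by (simp add: tail_prob_def gain_distr_def)
qed

definition thresholds :: "uplink \<Rightarrow> nat \<Rightarrow> real set" where
  "thresholds S k = {t. 0 \<le> t \<and> 0 < tail_prob S k t}"

definition inv_gain_integral :: "uplink \<Rightarrow> nat \<Rightarrow> real \<Rightarrow> ennreal" where
  "inv_gain_integral S k t = (\<integral>\<^sup>+ x \<in> {t..}. ennreal (gain_pdf S k x / x) \<partial>lborel)"

text \<open>
  Truncated channel inversion transmits with power \<open>c / \<gamma>\<close> when \<open>\<gamma> \<ge> t\<close> and is silent otherwise,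
  where \<open>c\<close> makes the average power equal to \<open>P\<^sub>m\<^sub>a\<^sub>x / n\<close>. The received SNR is then the constant
  \<open>c / (N\<^sub>0 B\<^sub>0 d\<^sub>k powr \<alpha>)\<close>.
\<close>

definition snr :: "uplink \<Rightarrow> nat \<Rightarrow> real \<Rightarrow> nat \<Rightarrow> real" where
  "snr S k t n =
     (if inv_gain_integral S k t = \<infinity> then 0
      else max_power S /
        (real n * noise S * spacing S * distance S k powr path_loss S
          * enn2real (inv_gain_integral S k t)))"

definition rate :: "uplink \<Rightarrow> nat \<Rightarrow> real \<Rightarrow> nat \<Rightarrow> real" where
  "rate S k t n =
     spacing S * log 2 (1 + 1.5 * snr S k t n / (- ln (5 * ber S))) * tail_prob S k t"

text \<open>
  For a heavy-tailed gain the rate may have no maximizing threshold and may even be unbounded,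
  so the maximum over the thresholds is taken as a supremum in the extended reals. Where the
  maximum is attained the two agree, see \<open>avg_rate_eq_max\<close> below.
\<close>

definition avg_rate :: "uplink \<Rightarrow> nat \<Rightarrow> nat \<Rightarrow> ereal" where
  "avg_rate S k n =
     (if n = 0 then 0 else ereal (real n) * (SUP t \<in> thresholds S k. ereal (rate S k t n)))"

definition optimal_threshold :: "uplink \<Rightarrow> nat \<Rightarrow> nat \<Rightarrow> real \<Rightarrow> bool" where
  "optimal_threshold S k n t \<longleftrightarrow> is_arg_max (\<lambda>t. rate S k t n) (\<lambda>t. t \<in> thresholds S k) t"

lemma avg_rate_eq_max:
  assumes "optimal_threshold S k n t" "n \<noteq> 0"
  shows "avg_rate S k n = ereal (real n * rate S k t n)"
proof -
  have "(SUP t \<in> thresholds S k. ereal (rate S k t n)) = ereal (rate S k t n)"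
    using assms(1) unfolding optimal_threshold_def is_arg_max_linorder
    by (intro SUP_eqI) auto
  then show ?thesis
    using assms(2) by (simp add: avg_rate_def)
qed

inductive greedy_reachable :: "(nat \<Rightarrow> nat \<Rightarrow> ereal) \<Rightarrow> nat \<Rightarrow> nat \<Rightarrow> (nat \<Rightarrow> nat) \<Rightarrow> bool"
  for U :: "nat \<Rightarrow> nat \<Rightarrow> ereal" and K :: nat and M :: nat where
  init: "greedy_reachable U K M (\<lambda>_. 1)"
| step: "greedy_reachable U K M a \<Longrightarrow> (\<Sum>k=1..K. a k) < M \<Longrightarrow>
    is_arg_min (\<lambda>k. U k (a k)) (\<lambda>k. k \<in> {1..K}) j \<Longrightarrow>
    greedy_reachable U K M (a(j := a j + 1))"

definition greedy_output :: "(nat \<Rightarrow> nat \<Rightarrow> ereal) \<Rightarrow> nat \<Rightarrow> nat \<Rightarrow> (nat \<Rightarrow> nat) \<Rightarrow> bool" where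
  "greedy_output U K M a \<longleftrightarrow> greedy_reachable U K M a \<and> \<not> (\<Sum>k=1..K. a k) < M"

text \<open>
  A user may receive the empty set; its rate is then the empty sum.
\<close>

definition is_allocation :: "nat \<Rightarrow> 'm set \<Rightarrow> (nat \<Rightarrow> 'm set) \<Rightarrow> bool" where
  "is_allocation K C A \<longleftrightarrow> (\<Union>k\<in>{1..K}. A k) = C \<and> disjoint_family_on A {1..K}"

definition feasible ::
    "uplink \<Rightarrow> nat \<Rightarrow> 'm set \<Rightarrow> (nat \<Rightarrow> 'm set) \<times> (nat \<Rightarrow> 'm \<Rightarrow> real) \<Rightarrow> bool" where
  "feasible S K C = (\<lambda>(A, th). is_allocation K C A \<and>
     (\<forall>k\<in>{1..K}. \<forall>m\<in>A k. th k m \<in> thresholds S k))"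

definition min_rate ::
    "uplink \<Rightarrow> nat \<Rightarrow> (nat \<Rightarrow> 'm set) \<times> (nat \<Rightarrow> 'm \<Rightarrow> real) \<Rightarrow> real" where
  "min_rate S K = (\<lambda>(A, th). MIN k\<in>{1..K}. \<Sum>m\<in>A k. rate S k (th k m) (card (A k)))"

definition max_min_optimal ::
    "uplink \<Rightarrow> nat \<Rightarrow> 'm set \<Rightarrow> (nat \<Rightarrow> 'm set) \<times> (nat \<Rightarrow> 'm \<Rightarrow> real) \<Rightarrow> bool" where
  "max_min_optimal S K C x \<longleftrightarrow> is_arg_max (min_rate S K) (feasible S K C) x"

end

theory Submission
  imports Defs
begin

text \<open>
  Each rate function \<open>U\<^sub>k\<close> is nonnegative, vanishes at \<open>0\<close> and is nondecreasing, because
  \<open>n ln (1 + x / n)\<close> is nondecreasing in \<open>n\<close> by concavity of the logarithm. Compare the greedy run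
  with an arbitrary allocation \<open>n\<close> of value \<open>w\<close>. As long as the greedy minimum is below \<open>w\<close>, the
  user \<open>j\<close> it selects has \<open>U\<^sub>j(a\<^sub>j) < w \<le> U\<^sub>j(n\<^sub>j)\<close>, so \<open>a\<^sub>j < n\<^sub>j\<close>: the greedy allocation never
  overtakes \<open>n\<close> beyond its initial ones before it reaches the value \<open>w\<close>. If it never reaches \<open>w\<close>,
  both allocations have the same total and are therefore equal, unless some \<open>n\<^sub>k = 0\<close>, in which
  case \<open>w \<le> 0\<close>.
\<close>

section \<open>A logarithmic inequality\<close>

lemma mult_ln_one_plus_divide_mono:
  fixes x s t :: real
  assumes "0 \<le> x" "0 < s" "s \<le> t"
  shows "s * ln (1 + x / s) \<le> t * ln (1 + x / t)"
proof -
  \<comment> \<open>The weight \<open>s / t\<close> on \<open>1 + x / s\<close> and the remaining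
    weight on \<open>1\<close>, where \<open>ln\<close> vanishes, average to
    \<open>1 + x / t\<close>.\<close>
  have "(1 - s / t) * ln 1 + s / t * ln (1 + x / s) \<le> ln ((1 - s / t) *\<^sub>R 1 + (s / t) *\<^sub>R (1 + x / s))"
    using assms by (intro concave_onD[OF ln_concave]) (auto simp: add_pos_nonneg)
  also have "(1 - s / t) *\<^sub>R 1 + (s / t) *\<^sub>R (1 + x / s) = 1 + x / t"
    using assms by (simp add: field_simps)
  finally show ?thesis
    using assms by (simp add: field_simps)
qed

section \<open>The greedy procedure for monotone rate functions\<close>

lemma greedy_reachable_pos:
  "greedy_reachable U K M a \<Longrightarrow> 1 \<le> a k"
  by (induction arbitrary: k rule: greedy_reachable.induct) (auto simp: le_SucI)

text \<open>The total starts at \<open>K\<close> and grows by one only while below \<open>M\<close>.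
  With the stopping condition of \<open>greedy_output\<close> it is exactly
  \<open>M\<close>.\<close>

lemma greedy_reachable_sum_le:
  assumes "greedy_reachable U K M a" "K \<le> M"
  shows "(\<Sum>k=1..K. a k) \<le> M"
  using assms(1)
proof (induction rule: greedy_reachable.induct)
  case init
  show ?case using assms(2) by simp
next
  case (step a j)
  have "j \<in> {1..K}"
    using step.hyps(3) by (simp add: is_arg_min_def)
  then have "(\<Sum>k=1..K. (a(j := a j + 1)) k) = (\<Sum>k=1..K. a k) + 1"
    using sum.remove[of "{1..K}" j a] sum.remove[of "{1..K}" j "a(j := a j + 1)"] by simp
  then show ?case using step.hyps(2) by simp
qed

text \<open>The first alternative persists because counts only grow and \<open>U\<close> is
  monotone. In the second, \<open>max 1\<close> absorbs the initial ones, which may exceed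
  \<open>n k = 0\<close>.\<close>

lemma greedy_reachable_invariant:
  fixes U :: "nat \<Rightarrow> nat \<Rightarrow> ereal"
  assumes "greedy_reachable U K M a"
    and mono: "\<And>k i j. k \<in> {1..K} \<Longrightarrow> i \<le> j \<Longrightarrow> U k i \<le> U k j"
    and w: "\<And>k. k \<in> {1..K} \<Longrightarrow> w \<le> U k (n k)"
  shows "(\<forall>k\<in>{1..K}. w \<le> U k (a k)) \<or> (\<forall>k\<in>{1..K}. a k \<le> max 1 (n k))"
  using assms(1)
proof (induction rule: greedy_reachable.induct)
  case init
  show ?case by simp
next
  case (step a j)
  have j: "j \<in> {1..K}" and min: "\<And>k. k \<in> {1..K} \<Longrightarrow> U j (a j) \<le> U k (a k)"
    using step.hyps(3) by (auto simp: is_arg_min_linorder)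
  show ?case
  proof (cases "w \<le> U j (a j)")
    case True
    have "w \<le> U k ((a(j := a j + 1)) k)" if "k \<in> {1..K}" for k
    proof -
      have "w \<le> U k (a k)"
        using True min[OF that] by simp
      also have "\<dots> \<le> U k ((a(j := a j + 1)) k)"
        by (rule mono[OF that]) simp
      finally show ?thesis .
    qed
    then show ?thesis by blast
  next
    case False
    have "a j < n j"
    proof (rule ccontr)
      assume "\<not> a j < n j"
      then have "w \<le> U j (a j)"
        using w[OF j] mono[OF j, of "n j" "a j"] by simp
      with False show False by simp
    qed
    \<comment> \<open>The user \<open>j\<close> refutes the first alternative of the induction
      hypothesis, so the second holds before the increment.\<close>
    moreover have "\<forall>k\<in>{1..K}. a k \<le> max 1 (n k)"
      using step.IH False j by blast
    ultimately show ?thesis by auto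
  qed
qed

text \<open>A lower bound \<open>w\<close> in place of a minimum lets the lemma serve both for the
  real value of a choice of thresholds and for a minimum of average rates.\<close>

lemma greedy_output_ge:
  fixes U :: "nat \<Rightarrow> nat \<Rightarrow> ereal"
  assumes out: "greedy_output U K M a" and KM: "K \<le> M"
    and mono: "\<And>k i j. k \<in> {1..K} \<Longrightarrow> i \<le> j \<Longrightarrow> U k i \<le> U k j"
    and zero: "\<And>k. k \<in> {1..K} \<Longrightarrow> U k 0 = 0"
    and n: "(\<Sum>k=1..K. n k) = M"
    and w: "\<And>k. k \<in> {1..K} \<Longrightarrow> w \<le> U k (n k)"
    and l: "l \<in> {1..K}"
  shows "w \<le> U l (a l)"
proof (cases "\<exists>k\<in>{1..K}. n k = 0")
  case True
  then have "w \<le> 0"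
    using w zero by metis
  also have "0 \<le> U l (a l)"
    using mono[OF l, of 0 "a l"] zero[OF l] by simp
  finally show ?thesis .
next
  case False
  have reach: "greedy_reachable U K M a" and "\<not> (\<Sum>k=1..K. a k) < M"
    using out by (auto simp: greedy_output_def)
  then have sum: "(\<Sum>k=1..K. a k) = (\<Sum>k=1..K. n k)"
    using greedy_reachable_sum_le[OF reach KM] n by simp
  consider "\<forall>k\<in>{1..K}. w \<le> U k (a k)" | "\<forall>k\<in>{1..K}. a k \<le> max 1 (n k)"
    using greedy_reachable_invariant[OF reach mono w] by blast
  then show ?thesis
  proof cases
    case 1
    then show ?thesis using l by blast
  next
    case 2
    have "a k \<le> n k" if "k \<in> {1..K}" for k
    proof -
      have "n k \<noteq> 0" using False that by metis
      then show ?thesis using bspec[OF 2 that] by simp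
    qed
    \<comment> \<open>Termwise \<open>a k \<le> n k\<close> with equal totals forces equality in
      every term.\<close>
    then have "a l = n l"
      using sum_mono_inv[OF sum _ l] by simp
    then show ?thesis using w[OF l] by simp
  qed
qed

section \<open>Rates over the channel\<close>

context uplink_channel
begin

text \<open>The SNR is proportional to \<open>1 / n\<close>, so this factor isolates the dependence
  of the rate on \<open>n\<close>.\<close>

definition log_slope :: "nat \<Rightarrow> real \<Rightarrow> real" where
  "log_slope k t = 1.5 * snr S k t 1 / (- ln (5 * ber S))"

lemma log_slope_nonneg:
  assumes "k \<in> {1..K}"
  shows "0 \<le> log_slope k t"
proof -
  have "ln (5 * ber S) < 0"
    using ber_bounds by simp
  moreover have "0 \<le> snr S k t 1"
    using noise_pos spacing_pos max_power_pos by (simp add: snr_def)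
  ultimately show ?thesis
    unfolding log_slope_def by (intro divide_nonneg_pos) auto
qed

lemma rate_eq:
  "rate S k t n = spacing S / ln 2 * tail_prob S k t * ln (1 + log_slope k t / real n)"
proof -
  have "snr S k t n = snr S k t 1 / real n"
    by (simp add: snr_def field_simps)
  then have "1.5 * snr S k t n / (- ln (5 * ber S)) = log_slope k t / real n"
    by (simp add: log_slope_def mult_ac)
  then show ?thesis
    unfolding rate_def log_def by simp
qed

lemma rate_nonneg:
  assumes "k \<in> {1..K}"
  shows "0 \<le> rate S k t n"
  unfolding rate_eq using log_slope_nonneg[OF assms] spacing_pos
  by (intro mult_nonneg_nonneg) (auto simp: tail_prob_def)

lemma mult_rate_mono:
  assumes "k \<in> {1..K}" "0 < i" "i \<le> j"
  shows "real i * rate S k t i \<le> real j * rate S k t j"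
proof -
  have "real i * ln (1 + log_slope k t / real i) \<le> real j * ln (1 + log_slope k t / real j)"
    using assms by (intro mult_ln_one_plus_divide_mono log_slope_nonneg) auto
  then have "spacing S / ln 2 * tail_prob S k t * (real i * ln (1 + log_slope k t / real i))
      \<le> spacing S / ln 2 * tail_prob S k t * (real j * ln (1 + log_slope k t / real j))"
    using spacing_pos by (intro mult_left_mono) (auto simp: tail_prob_def)
  then show ?thesis
    by (simp add: rate_eq mult_ac)
qed

text \<open>Gains are almost surely positive, so the tail probability at \<open>0\<close> is 1. The
  sub-carrier \<open>m\<close> is what links the density to an actual gain.\<close>

lemma zero_in_thresholds:
  assumes "k \<in> {1..K}" "m \<in> C"
  shows "0 \<in> thresholds S k"
proof -
  have "gain k m \<in> borel_measurable P"
    using distributed_measurable[OF gain_distributed[OF assms]] by simp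
  then have "prob {\<omega> \<in> space P. 0 \<le> gain k m \<omega>} = 1"
    using gain_pos[OF assms] by (subst prob_Collect_eq_1) auto
  then show ?thesis
    using prob_gain_ge[OF assms, of 0] by (simp add: thresholds_def)
qed

text \<open>The factor \<open>n\<close> moves inside the supremum because the threshold set is
  nonempty and the rates are nonnegative.\<close>

lemma avg_rate_eq_SUP:
  assumes "k \<in> {1..K}" "C \<noteq> {}" "n \<noteq> 0"
  shows "avg_rate S k n = (SUP t \<in> thresholds S k. ereal (real n * rate S k t n))"
proof -
  have "thresholds S k \<noteq> {}"
    using zero_in_thresholds assms by blast
  then show ?thesis
    using assms rate_nonneg
    by (simp add: avg_rate_def SUP_ereal_mult_left flip: times_ereal.simps(1))
qed

lemma mult_rate_le_avg_rate:
  assumes "k \<in> {1..K}" "C \<noteq> {}" "t \<in> thresholds S k" "n \<noteq> 0"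
  shows "ereal (real n * rate S k t n) \<le> avg_rate S k n"
  unfolding avg_rate_eq_SUP[OF assms(1,2,4)] by (rule SUP_upper[OF assms(3)])

lemma avg_rate_mono:
  assumes k: "k \<in> {1..K}" and C: "C \<noteq> {}" and "i \<le> j"
  shows "avg_rate S k i \<le> avg_rate S k j"
proof (cases "j = 0")
  case True
  then show ?thesis using \<open>i \<le> j\<close> by simp
next
  case j: False
  show ?thesis
  proof (cases "i = 0")
    case True
    obtain m where "m \<in> C" using C by blast
    have "avg_rate S k i \<le> ereal (real j * rate S k 0 j)"
      using True rate_nonneg[OF k] by (simp add: avg_rate_def)
    also have "\<dots> \<le> avg_rate S k j"
      by (rule mult_rate_le_avg_rate[OF k C zero_in_thresholds[OF k \<open>m \<in> C\<close>] j])
    finally show ?thesis .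
  next
    case False
    then show ?thesis
      unfolding avg_rate_eq_SUP[OF k C False] avg_rate_eq_SUP[OF k C j]
      using mult_rate_mono[OF k] \<open>i \<le> j\<close> by (intro SUP_mono') simp
  qed
qed

lemma sum_rate_le_avg_rate:
  assumes k: "k \<in> {1..K}" and C: "C \<noteq> {}" and "finite B"
    and th: "\<And>m. m \<in> B \<Longrightarrow> th m \<in> thresholds S k"
  shows "ereal (\<Sum>m\<in>B. rate S k (th m) (card B)) \<le> avg_rate S k (card B)"
proof (cases "B = {}")
  case True
  then show ?thesis by (simp add: avg_rate_def)
next
  case False
  let ?r = "\<lambda>m. rate S k (th m) (card B)"
  \<comment> \<open>Thresholds may differ across \<open>B\<close> and the supremum need not be
    attained, so all rates are bounded by the largest one occurring in the finite set
    \<open>B\<close>.\<close>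
  obtain m where m: "m \<in> B" "\<And>x. x \<in> B \<Longrightarrow> ?r x \<le> ?r m"
    using False \<open>finite B\<close> Max_in[of "?r ` B"] Max_ge[of "?r ` B"] by fastforce
  have "(\<Sum>m\<in>B. ?r m) \<le> real (card B) * ?r m"
    using m(2) by (rule sum_bounded_above)
  also have "ereal \<dots> \<le> avg_rate S k (card B)"
    using False \<open>finite B\<close> by (intro mult_rate_le_avg_rate[OF k C th[OF m(1)]]) auto
  finally show ?thesis by simp
qed

lemma sum_rate_eq_avg_rate:
  assumes "finite B" "B \<noteq> {}"
    and th: "\<And>m. m \<in> B \<Longrightarrow> optimal_threshold S k (card B) (th m)"
  shows "ereal (\<Sum>m\<in>B. rate S k (th m) (card B)) = avg_rate S k (card B)"
proof -
  have card: "card B \<noteq> 0" using assms(1,2) by simp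
  obtain b where b: "b \<in> B" using assms(2) by blast
  \<comment> \<open>Maximizing thresholds need not be unique, but they all give the same
    rate.\<close>
  have "rate S k (th m) (card B) = rate S k (th b) (card B)" if "m \<in> B" for m
    using avg_rate_eq_max[OF th[OF that] card] avg_rate_eq_max[OF th[OF b] card] card by simp
  then have "(\<Sum>m\<in>B. rate S k (th m) (card B)) = real (card B) * rate S k (th b) (card B)"
    by simp
  then show ?thesis
    using avg_rate_eq_max[OF th[OF b] card] by simp
qed

end

section \<open>Sizes of allocations\<close>

lemma is_allocation_sum_card:
  assumes "is_allocation K C A" "finite C"
  shows "(\<Sum>k=1..K. card (A k)) = card C"
proof -
  have "finite (A k)" if "k \<in> {1..K}" for k
    using assms that by (auto simp: is_allocation_def intro: finite_subset)
  then show ?thesis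
    using assms(1) card_UN_disjoint[of "{1..K}" A]
    by (auto simp: is_allocation_def disjoint_family_on_def)
qed

text \<open>Makes \<open>Max\<close> meaningful. Infinitely many \<open>n\<close> occur, being
  unconstrained outside \<open>{1..K}\<close>, but the value depends only on the restriction to
  \<open>{1..K}\<close>, whose entries are at most \<open>M\<close>.\<close>

lemma finite_allocation_values:
  fixes K M :: nat
  shows "finite {(MIN k\<in>{1..K}. U k (n k)) | n. (\<Sum>k=1..K. n k) = M}"
proof (rule finite_subset)
  show "finite ((\<lambda>n. MIN k\<in>{1..K}. U k (n k)) ` ({1..K} \<rightarrow>\<^sub>E {..M}))"
    by (intro finite_imageI finite_PiE) auto
  show "{(MIN k\<in>{1..K}. U k (n k)) | n. (\<Sum>k=1..K. n k) = M}
      \<subseteq> (\<lambda>n. MIN k\<in>{1..K}. U k (n k)) ` ({1..K} \<rightarrow>\<^sub>E {..M})"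
  proof clarify
    fix n assume "M = (\<Sum>k=1..K. n k)"
    then have "restrict n {1..K} \<in> {1..K} \<rightarrow>\<^sub>E {..\<Sum>k=1..K. n k}"
      by (auto intro: member_le_sum)
    then show "(MIN k\<in>{1..K}. U k (n k))
        \<in> (\<lambda>n. MIN k\<in>{1..K}. U k (n k)) ` ({1..K} \<rightarrow>\<^sub>E {..\<Sum>k=1..K. n k})"
      by (rule rev_image_eqI) (simp cong: image_cong_simp)
  qed
qed

section \<open>Optimality of the greedy allocation\<close>

theorem theorem1:
  fixes P :: "'w measure" and S :: uplink and K :: nat and C :: "'m set"
    and gain :: "nat \<Rightarrow> 'm \<Rightarrow> 'w \<Rightarrow> real" and a :: "nat \<Rightarrow> nat"
  assumes "uplink_channel P S K C gain"
    and "1 \<le> K" and "finite C" and "K \<le> card C"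
    and "greedy_output (avg_rate S) K (card C) a"
  shows "(\<forall>A th. is_allocation K C A \<and> (\<forall>k\<in>{1..K}. card (A k) = a k) \<and>
             (\<forall>k\<in>{1..K}. \<forall>m\<in>A k. optimal_threshold S k (a k) (th k m)) \<longrightarrow>
             max_min_optimal S K C (A, th)) \<and>
         (MIN k\<in>{1..K}. avg_rate S k (a k)) =
           Max {(MIN k\<in>{1..K}. avg_rate S k (n k)) | n. (\<Sum>k=1..K. n k) = card C}"
proof -
  interpret uplink_channel P S K C gain by fact
  have C: "C \<noteq> {}" using assms(2,4) by auto
  have ne: "{1..K} \<noteq> {}" using assms(2) by simp
  have reach: "greedy_reachable (avg_rate S) K (card C) a"
    using assms(5) by (simp add: greedy_output_def)
  have zero: "avg_rate S k 0 = 0" for k by (simp add: avg_rate_def)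
  have best: "w \<le> avg_rate S l (a l)"
    if "(\<Sum>k=1..K. n k) = card C" "\<And>k. k \<in> {1..K} \<Longrightarrow> w \<le> avg_rate S k (n k)" "l \<in> {1..K}"
    for w n l
    using assms(5,4) avg_rate_mono[OF _ C] zero that by (rule greedy_output_ge)
  have sum_a: "(\<Sum>k=1..K. a k) = card C"
    using greedy_reachable_sum_le[OF reach assms(4)] assms(5) by (simp add: greedy_output_def)
  have "max_min_optimal S K C (A, th)"
    if A: "is_allocation K C A" and card: "\<And>k. k \<in> {1..K} \<Longrightarrow> card (A k) = a k"
      and th: "\<And>k m. k \<in> {1..K} \<Longrightarrow> m \<in> A k \<Longrightarrow> optimal_threshold S k (a k) (th k m)"
    for A th
    unfolding max_min_optimal_def is_arg_max_linorder
  proof (intro conjI allI impI)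
    show "feasible S K C (A, th)"
      using A th by (auto simp: feasible_def optimal_threshold_def is_arg_max_def)
  next
    fix y assume "feasible S K C y"
    then obtain B u where y: "y = (B, u)" and B: "is_allocation K C B"
      and u: "\<And>k m. k \<in> {1..K} \<Longrightarrow> m \<in> B k \<Longrightarrow> u k m \<in> thresholds S k"
      by (cases y) (auto simp: feasible_def)
    have fin: "finite (B k)" if "k \<in> {1..K}" for k
      using B assms(3) that by (auto simp: is_allocation_def intro: finite_subset)
    have le: "ereal (min_rate S K y) \<le> avg_rate S k (card (B k))" if k: "k \<in> {1..K}" for k
    proof -
      have "min_rate S K y \<le> (\<Sum>m\<in>B k. rate S k (u k m) (card (B k)))"
        unfolding min_rate_def y using k by (auto intro!: Min_le)
      also have "ereal \<dots> \<le> avg_rate S k (card (B k))"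
        by (rule sum_rate_le_avg_rate[OF k C fin[OF k] u[OF k]])
      finally show ?thesis by simp
    qed
    have "min_rate S K y \<le> (\<Sum>m\<in>A k. rate S k (th k m) (card (A k)))" if k: "k \<in> {1..K}" for k
    proof -
      \<comment> \<open>Greedy counts are at least 1. Since infinite sets have \<open>card\<close>
        0, this gives finiteness as well as nonemptiness.\<close>
      have "card (A k) \<noteq> 0"
        using greedy_reachable_pos[OF reach, of k] card[OF k] by simp
      then have "finite (A k)" "A k \<noteq> {}"
        by (auto intro: card_ge_0_finite)
      then have "ereal (\<Sum>m\<in>A k. rate S k (th k m) (card (A k))) = avg_rate S k (card (A k))"
        using th[OF k] card[OF k] by (intro sum_rate_eq_avg_rate) auto
      then show ?thesis
        using best[OF is_allocation_sum_card[OF B assms(3)] le k] card[OF k]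
        by (metis ereal_less_eq(3))
    qed
    then show "min_rate S K y \<le> min_rate S K (A, th)"
      unfolding min_rate_def[of S K] using ne by (simp add: min_rate_def)
  qed
  moreover have "(MIN k\<in>{1..K}. avg_rate S k (a k)) =
      Max {(MIN k\<in>{1..K}. avg_rate S k (n k)) | n. (\<Sum>k=1..K. n k) = card C}"
  proof (rule sym, rule Max_eqI[OF finite_allocation_values])
    fix y assume "y \<in> {(MIN k\<in>{1..K}. avg_rate S k (n k)) | n. (\<Sum>k=1..K. n k) = card C}"
    then obtain n where n: "(\<Sum>k=1..K. n k) = card C"
      and y: "y = (MIN k\<in>{1..K}. avg_rate S k (n k))"
      by blast
    have "y \<le> avg_rate S k (n k)" if "k \<in> {1..K}" for k
      unfolding y using that by (auto intro!: Min_le)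
    then show "y \<le> (MIN k\<in>{1..K}. avg_rate S k (a k))"
      using ne best[OF n] by simp
  next
    show "(MIN k\<in>{1..K}. avg_rate S k (a k))
        \<in> {(MIN k\<in>{1..K}. avg_rate S k (n k)) | n. (\<Sum>k=1..K. n k) = card C}"
      using sum_a by blast
  qed
  ultimately show ?thesis by blast
qed

end
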